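(* Let $\sigma\colon\operatorname{GL}(n)\to\operatorname{Sym}^{++}(n)$, $\sigma(A)=AA^*$, and let $\Theta$ denote an open subset of $\mathbb R^k$. 1. A smooth surface $\Theta\ni\theta\mapsto A(\theta)\in\operatorname{GL}(n)$ is horizontal for $\sigma$ if, and only if, $$\left(\frac{\partial}{\partial\theta_j}A^*(\theta)\right)A(\theta)=A^*(\theta)\left(\frac{\partial}{\partial\theta_j}A(\theta)\right),\qquad j=1,\dots,k,\ \theta\in\Theta .$$ 2. Let $A(\theta)=A_0+\sum_{i=1}^k\theta_i(A_i-A_0)$, $\theta\in\Theta$, be a surface in $\operatorname{GL}(n)$ with the $k$-simplex of $\mathbb R^k$ contained in $\Theta$. The surface is horizontal if, and only if, $A_j^*A_i=A_i^*A_j$ for all $i,j=0,\dots,k$. 3. Let $\Sigma_0,\Sigma_1\in\operatorname{Sym}^{++}(n)$ be given and choose $A_0,A_1$ such that $\Sigma_0=A_0A_0^*$ and $\Sigma_1=A_1A_1^*$. The line $A(\theta)=(1-\theta)A_0+\theta A_1$ is horizontal for $\theta$ in an open interval containing $0$ and $1$ if, and only if, $A_1=TA_0$ with $T\in\operatorname{Sym}^{++}(n)$. This implies that $T$ is the solution of the Riccati equation $T\Sigma_0T=\Sigma_1$. 4. Let $\Sigma_j=A_jA_j^*\in\operatorname{Sym}^{++}(n)$, $j=0,1,\dots,k$, be given. The surface $\theta\mapsto A_0+\sum_{j=1}^k\theta_j(A_j-A_0)$ is horizontal in an open set of parameters containing the $k$-simplex if, and only if, for all $i,j=0,\dots,k$,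 $A_i=T_{ij}A_j$ with $T_{ij}\in\operatorname{Sym}^{++}(n)$.
   Context: All matrices are real $n\times n$ and $A^*$ denotes the transpose. $\operatorname{GL}(n)$ is the set of invertible matrices, $\operatorname{Sym}(n)$ the space of symmetric matrices, $\operatorname{Sym}^{++}(n)$ the cone of positive-definite symmetric matrices. The $k$-simplex of $\mathbb R^k$ is $\{\theta:\theta_j\ge 0,\ \sum_{j=1}^k\theta_j\le 1\}$, with vertices $0,e_1,\dots,e_k$. The space of horizontal vectors at $A\in\operatorname{GL}(n)$ for $\sigma$ is $\mathcal H_A=\operatorname{Sym}(n)A$. A smooth surface $\theta\mapsto A(\theta)\in\operatorname{GL}(n)$, $\theta\in\Theta$, $\Theta\subset\mathbb R^k$ open, is called horizontal for $\sigma$ if $\frac{\partial}{\partial\theta_j}A(\theta)\in\mathcal H_{A(\theta)}$ for each $j$ and each $\theta\in\Theta$, i.e. $\left(\frac{\partial}{\partial\theta_j}A(\theta)\right)A(\theta)^{-1}\in\operatorname{Sym}(n)$; in particular a horizontal surface takes values in $\operatorname{GL}(n)$. *)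

theory Defs
  imports "HOL-Analysis.Analysis"
begin

definition GL :: "(real^'n^'n) set" where
  "GL = {A. invertible A}"

definition Sym :: "(real^'n^'n) set" where
  "Sym = {S. transpose S = S}"

definition Sym_pd :: "(real^'n^'n) set" where
  "Sym_pd = {S \<in> Sym. \<forall>x. x \<noteq> 0 \<longrightarrow> x \<bullet> (S *v x) > 0}"

definition sigma_map :: "real^'n^'n \<Rightarrow> real^'n^'n" where
  "sigma_map A = A ** transpose A"

lemma sigma_map_in_Sym_pd:
  assumes "A \<in> GL"
  shows "sigma_map A \<in> Sym_pd"
proof -
  have sym: "sigma_map A \<in> Sym"
    by (simp add: Sym_def sigma_map_def matrix_transpose_mul)
  have "x \<bullet> (sigma_map A *v x) > 0" if "x \<noteq> 0" for x
  proof -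
    have "invertible (transpose A)"
      using assms by (simp add: GL_def invertible_det_nz)
    then have "transpose A *v x \<noteq> 0"
      using that by (metis invertible_def matrix_left_invertible_ker)
    moreover have "x \<bullet> (sigma_map A *v x) = (transpose A *v x) \<bullet> (transpose A *v x)"
      by (simp add: sigma_map_def dot_lmul_matrix flip: matrix_vector_mul_assoc)
    ultimately show ?thesis by simp
  qed
  with sym show ?thesis by (simp add: Sym_pd_def)
qed

definition unit_simplex :: "(real^'k) set" where
  "unit_simplex = {\<theta>. (\<forall>j. \<theta> $ j \<ge> 0) \<and> (\<Sum>j\<in>UNIV. \<theta> $ j) \<le> 1}"

text \<open>\<^term>\<open>b\<close> is meant to range over the standard basis; for parameters in
  \<^typ>\<open>real^'k\<close> the \<open>j\<close>-th basis vector is \<open>axis j 1\<close>, for real parameters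
  the only basis vector is \<open>1\<close>.\<close>

definition partial :: "'p::euclidean_space \<Rightarrow> ('p \<Rightarrow> 'v::real_normed_vector) \<Rightarrow> 'p \<Rightarrow> 'v" where
  "partial b f \<theta> = vector_derivative (\<lambda>t. f (\<theta> + t *\<^sub>R b)) (at 0)"

text \<open>The following two notions are only meaningful on open sets, where the derivatives inside
  the set do not depend on values outside it.\<close>

primrec Ck_on :: "nat \<Rightarrow> 'p::real_normed_vector set \<Rightarrow> ('p \<Rightarrow> 'v::real_normed_vector) \<Rightarrow> bool" where
  "Ck_on 0 S f \<longleftrightarrow> continuous_on S f"
| "Ck_on (Suc m) S f \<longleftrightarrow> (\<forall>x\<in>S. f differentiable (at x)) \<and>
     (\<forall>v. Ck_on m S (\<lambda>x. frechet_derivative f (at x) v))"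

definition smooth_on :: "'p::real_normed_vector set \<Rightarrow> ('p \<Rightarrow> 'v::real_normed_vector) \<Rightarrow> bool" where
  "smooth_on S f \<longleftrightarrow> (\<forall>m. Ck_on m S f)"

definition smooth_surface :: "'p::euclidean_space set \<Rightarrow> ('p \<Rightarrow> real^'n^'n) \<Rightarrow> bool" where
  "smooth_surface \<Theta> A \<longleftrightarrow> open \<Theta> \<and> smooth_on \<Theta> A \<and> (\<forall>\<theta>\<in>\<Theta>. A \<theta> \<in> GL)"

text \<open>The space of horizontal vectors at \<open>A\<close> for \<^const>\<open>sigma_map\<close>.\<close>

definition horizontal_vectors :: "real^'n^'n \<Rightarrow> (real^'n^'n) set" where
  "horizontal_vectors A = {S ** A | S. S \<in> Sym}"

definition horizontal :: "'p::euclidean_space set \<Rightarrow> ('p \<Rightarrow> real^'n^'n) \<Rightarrow> bool" where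
  "horizontal \<Theta> A \<longleftrightarrow> smooth_surface \<Theta> A \<and>
     (\<forall>b\<in>Basis. \<forall>\<theta>\<in>\<Theta>. partial b A \<theta> \<in> horizontal_vectors (A \<theta>))"

text \<open>The vertices \<open>0, 1, \<dots>, k\<close> are indexed by \<^typ>\<open>'k option\<close>, with \<^const>\<open>None\<close> as the
  index \<open>0\<close>.\<close>

definition affine_surface :: "('k option \<Rightarrow> real^'n^'n) \<Rightarrow> real^'k \<Rightarrow> real^'n^'n" where
  "affine_surface A \<theta> = A None + (\<Sum>i\<in>UNIV. \<theta> $ i *\<^sub>R (A (Some i) - A None))"

end

theory Submission
  imports Defs
begin

text \<open>
  For invertible \<open>A\<close>, a vector \<open>D\<close> is horizontal at \<open>A\<close> when \<open>D A\<inverse>\<close> is symmetric; the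
  congruence \<open>S \<mapsto> A\<^sup>* S A\<close> turns this into symmetry of \<open>A\<^sup>* D\<close>
  (\<open>horizontal_vectors_iff\<close>). This is the differential criterion, and unlike the original
  condition it is bilinear in \<open>A\<close> and \<open>D\<close>. For an affine surface the partial derivatives are the
  constants \<open>A\<^sub>j - A\<^sub>0\<close>, so by bilinearity horizontality on the whole parameter set is decided at
  the vertices of the simplex, where it says that all \<open>A\<^sub>i\<^sup>* A\<^sub>j\<close> are symmetric
  (\<open>horizontal_affine_surface_iff\<close>).

  Symmetry of \<open>A\<^sup>* B\<close> makes \<open>T = B A\<inverse>\<close> symmetric. It is moreover positive definite if the segment
  from \<open>A\<close> to \<open>B\<close> stays invertible: at a parameter \<open>t\<close> the segment is \<open>((1 - t) I + t T) A\<close>, and an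
  eigenvalue \<open>l \<le> 0\<close> of \<open>T\<close> would make the first factor singular at \<open>t = 1 / (1 - l)\<close>
  (\<open>Sym_pd_ratio_if_segment_in_GL\<close>). Conversely, convex combinations of positive-definite matrices
  are positive definite, so positive-definite ratios keep the surface invertible on the simplex;
  the parameters with invertible value then form an open set that contains the simplex.

  Finally, \<open>T\<close> solves the Riccati equation because \<open>T A A\<^sup>* T = B B\<^sup>*\<close>. The congruence by \<open>A\<close> turns
  uniqueness of its solution into uniqueness of positive-definite square roots. All spectral
  arguments need only the least eigenvalue of a symmetric matrix, attained at a minimizer of the
  quadratic form on the unit sphere (\<open>Sym_least_eigenvalue\<close>).
\<close>

section \<open>Symmetric and positive-definite matrices\<close>

lemma subspace_Sym: "subspace (Sym :: (real^'n^'n) set)"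
  by (auto simp: subspace_def Sym_def transpose_def vec_eq_iff)

lemma linear_transpose: "linear (transpose :: real^'n^'m \<Rightarrow> real^'m^'n)"
  by (auto intro!: linearI simp: transpose_def vec_eq_iff)

lemma linear_transpose_mult: "linear (\<lambda>X :: real^'n^'m. transpose X ** (C :: real^'p^'m))"
  by (auto intro!: linearI simp: transpose_def vec_eq_iff matrix_matrix_mult_def
      sum.distrib sum_distrib_left algebra_simps)

lemma matrix_mult_diff_right: "C ** (X - Y) = C ** X - C ** (Y :: real^'p^'m)" for C :: "real^'m^'n"
  by (simp add: vec_eq_iff matrix_matrix_mult_def sum_subtractf algebra_simps)

lemma Sym_inner:
  assumes "T \<in> Sym"
  shows "x \<bullet> (T *v y) = (T *v x) \<bullet> y"
  using assms by (metis (mono_tags, lifting) Sym_def dot_lmul_matrix mem_Collect_eq transpose_matrix_vector)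

lemma inner_transpose_mult: "x \<bullet> (transpose A *v y) = (A *v x) \<bullet> (y :: real^'m)"
  by (metis dot_lmul_matrix inner_commute transpose_matrix_vector)

lemma transpose_mult_in_Sym_iff:
  "transpose A ** B \<in> Sym \<longleftrightarrow> transpose B ** A = transpose A ** (B :: real^'n^'n)"
  by (simp add: Sym_def matrix_transpose_mul)

lemma transpose_mult_self_Sym: "transpose A ** (A :: real^'n^'n) \<in> Sym"
  by (simp add: transpose_mult_in_Sym_iff)

lemma congruence_Sym:
  fixes S A :: "real^'n^'n"
  assumes "S \<in> Sym"
  shows "transpose A ** S ** A \<in> Sym"
  using assms by (simp add: Sym_def matrix_transpose_mul matrix_mul_assoc)

lemma GL_iff_inj: "A \<in> GL \<longleftrightarrow> (\<forall>x. A *v x = 0 \<longrightarrow> x = 0)"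
  by (simp add: GL_def invertible_left_inverse matrix_left_invertible_ker)

lemma GL_inverse:
  fixes A :: "real^'n^'n"
  assumes "A \<in> GL"
  obtains C where "A ** C = mat 1" and "C ** A = mat 1"
  using assms by (auto simp: GL_def invertible_def)

lemma GL_mult: "A \<in> GL \<Longrightarrow> B \<in> GL \<Longrightarrow> A ** B \<in> GL"
  by (simp add: GL_def invertible_mult)

lemma open_GL: "open (GL :: (real^'n^'n) set)"
proof -
  have "continuous_on UNIV (det :: real^'n^'n \<Rightarrow> real)"
    unfolding det_def by (intro continuous_intros)
  then have "open (det -` (- {0}) :: (real^'n^'n) set)"
    by (simp add: continuous_on_open_vimage open_Compl)
  also have "det -` (- {0}) = (GL :: (real^'n^'n) set)"
    by (auto simp: GL_def invertible_det_nz)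
  finally show ?thesis .
qed

lemma Sym_pd_subset_GL: "Sym_pd \<subseteq> GL"
  by (force simp: GL_iff_inj Sym_pd_def)

lemma congruence_Sym_pd:
  fixes S A :: "real^'n^'n"
  assumes "S \<in> Sym_pd" "A \<in> GL"
  shows "transpose A ** S ** A \<in> Sym_pd"
proof -
  have "x \<bullet> ((transpose A ** S ** A) *v x) = (A *v x) \<bullet> (S *v (A *v x))" for x
    by (metis inner_transpose_mult matrix_vector_mul_assoc)
  then show ?thesis
    using assms congruence_Sym[of S A] by (auto simp: Sym_pd_def GL_iff_inj)
qed

lemma GL_if_sigma_map_Sym_pd:
  assumes "sigma_map A \<in> Sym_pd"
  shows "A \<in> GL"
proof -
  have "transpose A *v x \<noteq> 0" if "x \<noteq> 0" for x
  proof
    assume "transpose A *v x = 0"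
    then have "sigma_map A *v x = 0"
      unfolding sigma_map_def by (metis matrix_vector_mul_assoc matrix_vector_mult_0_right)
    with assms that show False
      by (force simp: Sym_pd_def)
  qed
  then have "transpose A \<in> GL"
    unfolding GL_iff_inj by blast
  then show ?thesis
    by (simp add: GL_def invertible_det_nz)
qed

text \<open>The quadratic form of the combination is the same combination of positive numbers, and at least
  one weight is positive since the weights have sum one.\<close>

lemma convex_combination_Sym_pd:
  fixes T :: "'i::finite \<Rightarrow> real^'n^'n"
  assumes T: "\<And>i. T i \<in> Sym_pd" and w: "\<And>i. w i \<ge> 0" "sum w UNIV = 1"
  shows "(\<Sum>i\<in>UNIV. w i *\<^sub>R T i) \<in> Sym_pd"
proof -
  have form: "x \<bullet> ((\<Sum>i\<in>UNIV. w i *\<^sub>R T i) *v x) = (\<Sum>i\<in>UNIV. w i * (x \<bullet> (T i *v x)))" for x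
  proof -
    have lin: "linear (\<lambda>S. x \<bullet> (S *v x))"
      by (rule linearI) (simp_all add: matrix_vector_mult_add_rdistrib inner_add_right
          flip: scaleR_matrix_vector_assoc)
    show ?thesis
      by (simp add: linear_sum[OF lin] linear_cmul[OF lin])
  qed
  have "(\<Sum>i\<in>UNIV. w i * (x \<bullet> (T i *v x))) > 0" if "x \<noteq> 0" for x
  proof -
    have pos: "x \<bullet> (T i *v x) > 0" for i
      using T that by (auto simp: Sym_pd_def)
    obtain i where "w i > 0"
      using w by (metis less_eq_real_def sum.neutral zero_neq_one)
    then show ?thesis
      using pos w(1) by (intro sum_pos2[of _ i]) (auto intro: mult_nonneg_nonneg less_imp_le)
  qed
  moreover have "(\<Sum>i\<in>UNIV. w i *\<^sub>R T i) \<in> Sym"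
    using T by (intro subspace_sum[OF subspace_Sym] subspace_scale[OF subspace_Sym])
      (auto simp: Sym_pd_def)
  ultimately show ?thesis
    by (simp add: Sym_pd_def form)
qed

section \<open>The least eigenvalue of a symmetric matrix\<close>

text \<open>Moving from \<open>x\<close> in the direction \<open>- T x\<close> changes the form at first order by a negative multiple
  of \<open>T x \<bullet> T x\<close>; as the form vanishes at \<open>x\<close> and is nowhere negative, \<open>T x\<close> must be zero.\<close>

lemma psd_null_vector:
  fixes T :: "real^'n^'n"
  assumes sym: "T \<in> Sym" and psd: "\<And>y. y \<bullet> (T *v y) \<ge> 0" and null: "x \<bullet> (T *v x) = 0"
  shows "T *v x = 0"
proof (rule ccontr)
  define y where "y = T *v x"
  define c where "c = y \<bullet> (T *v y)"
  define p where "p = y \<bullet> y"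
  \<comment> \<open>The step \<open>t\<close> need only satisfy \<open>t c < 2 p\<close>; adding one avoids division by zero when
    \<open>c = 0\<close>.\<close>
  define t where "t = p / (c + 1)"
  assume "T *v x \<noteq> 0"
  then have "p > 0"
    by (simp add: p_def y_def)
  have "c \<ge> 0"
    using psd by (simp add: c_def)
  have "(x - t *\<^sub>R y) \<bullet> (T *v (x - t *\<^sub>R y)) = t\<^sup>2 * c - 2 * t * p"
    using null Sym_inner[OF sym, of x y]
    by (simp add: c_def p_def y_def inner_diff algebra_simps power2_eq_square inner_commute)
  then have "2 * t * p \<le> t\<^sup>2 * c"
    using psd[of "x - t *\<^sub>R y"] by simp
  moreover have "t > 0"
    using \<open>p > 0\<close> \<open>c \<ge> 0\<close> by (simp add: t_def)
  ultimately have "2 * p \<le> t * c"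
    by (simp add: power2_eq_square)
  also have "t * c \<le> p"
    using \<open>p > 0\<close> \<open>c \<ge> 0\<close> by (simp add: t_def field_simps)
  finally show False
    using \<open>p > 0\<close> by simp
qed

text \<open>A minimizer \<open>x\<close> of the quadratic form on the unit sphere, with minimum \<open>l\<close>, is a zero of the
  positive-semidefinite form of \<open>T - l I\<close>, hence lies in the kernel of that matrix.\<close>

lemma Sym_least_eigenvalue:
  fixes T :: "real^'n^'n"
  assumes sym: "T \<in> Sym"
  obtains l x where "x \<noteq> 0" "T *v x = l *\<^sub>R x" "\<And>y. y \<bullet> (T *v y) \<ge> l * (y \<bullet> y)"
proof -
  let ?S = "sphere 0 1 :: (real^'n) set"
  have "continuous_on ?S (\<lambda>x. x \<bullet> (T *v x))"
    by (intro continuous_intros linear_continuous_on matrix_vector_mul_bounded_linear)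
  moreover have "?S \<noteq> {}"
    by simp
  ultimately obtain x where x: "x \<in> ?S" and min: "\<forall>y\<in>?S. x \<bullet> (T *v x) \<le> y \<bullet> (T *v y)"
    using continuous_attains_inf[OF compact_sphere] by blast
  define l where "l = x \<bullet> (T *v x)"
  have bound: "y \<bullet> (T *v y) \<ge> l * (y \<bullet> y)" for y
  proof (cases "y = 0")
    case False
    define z where "z = (1 / norm y) *\<^sub>R y"
    have "z \<in> ?S"
      using False by (simp add: z_def)
    then have "l \<le> z \<bullet> (T *v z)"
      using min by (simp add: l_def)
    also have "\<dots> = (y \<bullet> (T *v y)) / (norm y)\<^sup>2"
      by (simp add: z_def matrix_vector_mult_scaleR power2_eq_square)
    finally show ?thesis
      using False by (simp add: field_simps power2_norm_eq_inner)
  qed simp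
  define N where "N = T - l *\<^sub>R mat 1"
  have N: "N *v y = T *v y - l *\<^sub>R y" for y
    by (simp add: N_def matrix_vector_mult_diff_rdistrib flip: scaleR_matrix_vector_assoc)
  have "N \<in> Sym"
    unfolding N_def using sym
    by (intro subspace_diff[OF subspace_Sym] subspace_scale[OF subspace_Sym]) (auto simp: Sym_def)
  moreover have "y \<bullet> (N *v y) \<ge> 0" for y
    using bound[of y] by (simp add: N inner_diff_right)
  moreover have "x \<bullet> (N *v x) = 0"
    using x by (simp add: N inner_diff_right l_def norm_eq_1)
  ultimately have "N *v x = 0"
    by (rule psd_null_vector)
  then have "T *v x = l *\<^sub>R x"
    by (simp add: N)
  moreover have "x \<noteq> 0"
    using x by auto
  ultimately show ?thesis
    using bound that by blast
qed

section \<open>Positive-definite square roots and the Riccati equation\<close>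

text \<open>If \<open>x\<close> is an eigenvector of \<open>P - Q\<close> with eigenvalue \<open>l\<close>, then
  \<open>l x \<bullet> (P x + Q x) = P x \<bullet> P x - Q x \<bullet> Q x = 0\<close>, and definiteness of \<open>P + Q\<close> forces \<open>l = 0\<close>.
  Applied to the least eigenvalue this bounds the form of \<open>P - Q\<close> from below.\<close>

lemma quadratic_form_mono_if_squares_eq:
  fixes P Q :: "real^'n^'n"
  assumes P: "P \<in> Sym_pd" and Q: "Q \<in> Sym_pd" and sq: "P ** P = Q ** Q"
  shows "y \<bullet> (Q *v y) \<le> y \<bullet> (P *v y)"
proof -
  have symPQ: "P \<in> Sym" "Q \<in> Sym"
    using P Q by (auto simp: Sym_pd_def)
  then have "P - Q \<in> Sym"
    by (rule subspace_diff[OF subspace_Sym])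
  then obtain l x where x: "x \<noteq> 0" and eig: "(P - Q) *v x = l *\<^sub>R x"
    and bound: "\<And>y. y \<bullet> ((P - Q) *v y) \<ge> l * (y \<bullet> y)"
    by (rule Sym_least_eigenvalue) blast
  have eig': "P *v x - Q *v x = l *\<^sub>R x"
    using eig by (simp add: matrix_vector_mult_diff_rdistrib)
  have "l * (x \<bullet> (P *v x) + x \<bullet> (Q *v x)) = (P *v x - Q *v x) \<bullet> (P *v x + Q *v x)"
    by (simp add: eig' inner_add_right distrib_left)
  also have "\<dots> = (P *v x) \<bullet> (P *v x) - (Q *v x) \<bullet> (Q *v x)"
    by (simp add: algebra_simps inner_commute)
  also have "\<dots> = x \<bullet> ((P ** P) *v x) - x \<bullet> ((Q ** Q) *v x)"
    using symPQ by (simp add: Sym_inner flip: matrix_vector_mul_assoc)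
  also have "\<dots> = 0"
    by (simp add: sq)
  finally have "l = 0"
    using P Q x by (force simp: Sym_pd_def dest: spec[of _ x])
  then show ?thesis
    using bound[of y] by (simp add: matrix_vector_mult_diff_rdistrib inner_diff_right)
qed

lemma Sym_pd_eq_if_squares_eq:
  fixes P Q :: "real^'n^'n"
  assumes P: "P \<in> Sym_pd" and Q: "Q \<in> Sym_pd" and sq: "P ** P = Q ** Q"
  shows "P = Q"
proof -
  have "y \<bullet> ((P - Q) *v y) = 0" for y
    using quadratic_form_mono_if_squares_eq[OF P Q sq, of y]
      quadratic_form_mono_if_squares_eq[OF Q P sq[symmetric], of y]
    by (simp add: matrix_vector_mult_diff_rdistrib inner_diff_right)
  moreover have "P - Q \<in> Sym"
    using P Q by (intro subspace_diff[OF subspace_Sym]) (auto simp: Sym_pd_def)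
  ultimately have "(P - Q) *v y = 0" for y
    by (intro psd_null_vector) simp_all
  then show ?thesis
    by (simp add: matrix_eq matrix_vector_mult_diff_rdistrib)
qed

text \<open>Multiplying \<open>S A A\<^sup>* S\<close> by \<open>A\<^sup>*\<close> on the left and \<open>A\<close> on the right gives the square of the
  positive-definite matrix \<open>A\<^sup>* S A\<close>, so uniqueness reduces to that of square roots.\<close>

lemma Riccati_unique:
  fixes S T A :: "real^'n^'n"
  assumes S: "S \<in> Sym_pd" and T: "T \<in> Sym_pd" and A: "A \<in> GL"
    and eq: "S ** sigma_map A ** S = T ** sigma_map A ** T"
  shows "S = T"
proof -
  let ?c = "\<lambda>X. transpose A ** X ** A"
  have square: "?c X ** ?c X = ?c (X ** sigma_map A ** X)" for X
    by (simp add: sigma_map_def matrix_mul_assoc)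
  have "?c S = ?c T"
    by (rule Sym_pd_eq_if_squares_eq)
      (simp_all only: square eq congruence_Sym_pd[OF S A] congruence_Sym_pd[OF T A])
  moreover obtain C where C: "A ** C = mat 1" "C ** A = mat 1"
    using GL_inverse[OF A] .
  have "X = transpose C ** ?c X ** C" for X
  proof -
    have "transpose C ** ?c X ** C = (transpose C ** transpose A) ** X ** (A ** C)"
      by (simp only: matrix_mul_assoc)
    also have "transpose C ** transpose A = mat 1"
      by (simp add: C flip: matrix_transpose_mul)
    finally show ?thesis
      by (simp add: C)
  qed
  ultimately show ?thesis
    by metis
qed

lemma Riccati_ratio:
  fixes A T :: "real^'n^'n"
  assumes "T \<in> Sym"
  shows "T ** sigma_map A ** T = sigma_map (T ** A)"
  using assms by (simp add: sigma_map_def Sym_def matrix_transpose_mul matrix_mul_assoc)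

section \<open>Segments of invertible matrices\<close>

text \<open>Invertibility along the whole segment is essential: symmetry of \<open>A\<^sup>* B\<close> and invertibility of the
  two endpoints give only a symmetric ratio, as \<open>B = - A\<close> shows.\<close>

lemma Sym_pd_ratio_if_segment_in_GL:
  fixes A B :: "real^'n^'n"
  assumes sym: "transpose A ** B \<in> Sym"
    and seg: "\<And>t. 0 \<le> t \<Longrightarrow> t \<le> 1 \<Longrightarrow> (1 - t) *\<^sub>R A + t *\<^sub>R B \<in> GL"
  shows "\<exists>T\<in>Sym_pd. B = T ** A"
proof -
  have "A \<in> GL"
    using seg[of 0] by simp
  then obtain C where C: "A ** C = mat 1" "C ** A = mat 1"
    by (rule GL_inverse)
  define T where "T = B ** C"
  have TA: "B = T ** A"
    by (simp add: T_def C flip: matrix_mul_assoc)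
  \<comment> \<open>\<open>T\<close> is the congruence of the symmetric matrix \<open>A\<^sup>* B\<close> by \<open>C\<close>.\<close>
  have "T = (transpose C ** transpose A) ** T"
    by (simp add: C flip: matrix_transpose_mul)
  also have "\<dots> = transpose C ** (transpose A ** B) ** C"
    by (simp add: T_def matrix_mul_assoc)
  finally have T: "T \<in> Sym"
    using congruence_Sym[OF sym, of C] by simp
  then obtain l x where x: "x \<noteq> 0" and eig: "T *v x = l *\<^sub>R x"
    and bound: "\<And>y. y \<bullet> (T *v y) \<ge> l * (y \<bullet> y)"
    by (rule Sym_least_eigenvalue) blast
  have "l > 0"
  proof (rule ccontr)
    assume "\<not> l > 0"
    \<comment> \<open>The parameter at which \<open>(1 - t) + t l\<close> vanishes; it lies in the segment because
      \<open>l \<le> 0\<close>.\<close>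
    define t where "t = 1 / (1 - l)"
    have t: "0 \<le> t" "t \<le> 1" "t * (1 - l) = 1"
      using \<open>\<not> l > 0\<close> by (auto simp: t_def)
    define y where "y = C *v x"
    have Ay: "A *v y = x"
      by (simp add: y_def C matrix_vector_mul_assoc)
    have By: "B *v y = l *\<^sub>R x"
      by (simp add: TA Ay eig flip: matrix_vector_mul_assoc)
    have "((1 - t) *\<^sub>R A + t *\<^sub>R B) *v y = (1 - t) *\<^sub>R x + (t * l) *\<^sub>R x"
      by (simp add: matrix_vector_mult_add_rdistrib Ay By flip: scaleR_matrix_vector_assoc)
    also have "\<dots> = (1 - t * (1 - l)) *\<^sub>R x"
      by (simp add: algebra_simps)
    also have "\<dots> = 0"
      by (simp add: t)
    finally have "y = 0"
      using seg[OF t(1,2)] by (simp add: GL_iff_inj)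
    with Ay x show False
      by simp
  qed
  have "y \<bullet> (T *v y) > 0" if "y \<noteq> 0" for y
  proof -
    have "0 < l * (y \<bullet> y)"
      using that \<open>l > 0\<close> by simp
    then show ?thesis
      using bound[of y] by linarith
  qed
  with T TA show ?thesis
    by (auto simp: Sym_pd_def)
qed

lemma transpose_mult_Sym_if_ratio:
  fixes A T :: "real^'n^'n"
  assumes "T \<in> Sym_pd"
  shows "transpose A ** (T ** A) \<in> Sym"
  using assms congruence_Sym[of T A] by (simp add: Sym_pd_def matrix_mul_assoc)

section \<open>Horizontality as symmetry\<close>

text \<open>Writing \<open>D = S A\<close>, the matrix \<open>A\<^sup>* D = A\<^sup>* S A\<close> is congruent to \<open>S\<close>, so one is symmetric exactly
  when the other is. The point of the right-hand side is that it involves no inverse of \<open>A\<close>.\<close>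

lemma horizontal_vectors_iff:
  fixes A D :: "real^'n^'n"
  assumes "A \<in> GL"
  shows "D \<in> horizontal_vectors A \<longleftrightarrow> transpose A ** D \<in> Sym"
proof
  assume "D \<in> horizontal_vectors A"
  then show "transpose A ** D \<in> Sym"
    by (auto simp: horizontal_vectors_def matrix_mul_assoc congruence_Sym)
next
  assume sym: "transpose A ** D \<in> Sym"
  obtain C where C: "A ** C = mat 1" "C ** A = mat 1"
    using GL_inverse[OF assms] .
  have "transpose C ** (transpose A ** D) ** C = (transpose C ** transpose A) ** (D ** C)"
    by (simp only: matrix_mul_assoc)
  also have "\<dots> = D ** C"
    by (simp add: C flip: matrix_transpose_mul)
  finally have "D ** C \<in> Sym"
    using congruence_Sym[OF sym, of C] by simp
  moreover have "D = D ** C ** A"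
    by (simp add: C flip: matrix_mul_assoc)
  ultimately show "D \<in> horizontal_vectors A"
    by (auto simp: horizontal_vectors_def)
qed

lemma horizontal_iff_Sym:
  assumes "smooth_surface \<Theta> A"
  shows "horizontal \<Theta> A \<longleftrightarrow>
    (\<forall>b\<in>Basis. \<forall>\<theta>\<in>\<Theta>. transpose (A \<theta>) ** partial b A \<theta> \<in> Sym)"
  using assms by (simp add: horizontal_def smooth_surface_def horizontal_vectors_iff)

lemma partial_line_has_vector_derivative:
  assumes "(f has_derivative L) (at \<theta>)"
  shows "((\<lambda>t. f (\<theta> + t *\<^sub>R b)) has_vector_derivative L b) (at 0)"
proof -
  have "((\<lambda>t. \<theta> + t *\<^sub>R b) has_derivative (\<lambda>t. t *\<^sub>R b)) (at 0)"
    by (auto intro!: derivative_eq_intros)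
  moreover have "(f has_derivative L) (at (\<theta> + 0 *\<^sub>R b))"
    using assms by simp
  ultimately have "((\<lambda>t. f (\<theta> + t *\<^sub>R b)) has_derivative (\<lambda>t. L (t *\<^sub>R b))) (at 0)"
    by (rule has_derivative_compose)
  moreover have "L (t *\<^sub>R b) = t *\<^sub>R L b" for t
    using assms by (simp add: has_derivative_linear linear_cmul)
  ultimately show ?thesis
    by (simp add: has_vector_derivative_def)
qed

lemma partial_eq:
  assumes "(f has_derivative L) (at \<theta>)"
  shows "partial b f \<theta> = L b"
  unfolding partial_def
  by (rule vector_derivative_at[OF partial_line_has_vector_derivative[OF assms]])

lemma partial_transpose:
  fixes A :: "'p::euclidean_space \<Rightarrow> real^'n^'m"
  assumes "A differentiable (at \<theta>)"
  shows "partial b (\<lambda>\<theta>. transpose (A \<theta>)) \<theta> = transpose (partial b A \<theta>)"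
proof -
  obtain L where L: "(A has_derivative L) (at \<theta>)"
    using assms by (auto simp: differentiable_def)
  have "((\<lambda>\<theta>. transpose (A \<theta>)) has_derivative (\<lambda>v. transpose (L v))) (at \<theta>)"
    using linear_transpose by (rule bounded_linear.has_derivative[OF linear_conv_bounded_linear[THEN iffD1] L])
  then show ?thesis
    using L by (simp add: partial_eq)
qed

lemma horizontal_iff_partial:
  fixes A :: "'p::euclidean_space \<Rightarrow> real^'n^'n"
  assumes "smooth_surface \<Theta> A"
  shows "horizontal \<Theta> A \<longleftrightarrow>
    (\<forall>b\<in>Basis. \<forall>\<theta>\<in>\<Theta>. partial b (\<lambda>\<theta>. transpose (A \<theta>)) \<theta> ** A \<theta> =
       transpose (A \<theta>) ** partial b A \<theta>)"
proof -
  have "A differentiable (at \<theta>)" if "\<theta> \<in> \<Theta>" for \<theta>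
  proof -
    have "Ck_on (Suc 0) \<Theta> A"
      using assms unfolding smooth_surface_def smooth_on_def by blast
    then show ?thesis
      using that by simp
  qed
  then show ?thesis
    using assms by (simp add: horizontal_iff_Sym transpose_mult_in_Sym_iff partial_transpose)
qed

lemma ball_Basis_vec: "(\<forall>b\<in>Basis. P b) \<longleftrightarrow> (\<forall>j. P (axis j (1::real)))"
  by (auto simp: Basis_vec_def)

section \<open>Affine maps\<close>

lemma smooth_on_const: "smooth_on S (\<lambda>x. c)"
proof -
  have "Ck_on m S (\<lambda>x. c)" for m and c :: 'b
    by (induction m arbitrary: c) (simp_all add: frechet_derivative_const)
  then show ?thesis
    by (simp add: smooth_on_def)
qed

lemma affine_has_derivative:
  fixes L :: "'p::euclidean_space \<Rightarrow> 'v::real_normed_vector"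
  assumes "linear L"
  shows "((\<lambda>x. c + L x) has_derivative L) (at \<theta>)"
proof -
  have "(L has_derivative L) (at \<theta>)"
    using assms by (intro bounded_linear_imp_has_derivative linear_conv_bounded_linear[THEN iffD1])
  then show ?thesis
    using has_derivative_add[OF has_derivative_const[of c]] by fastforce
qed

text \<open>All the directional derivatives of an affine map are constant functions, so one step of the
  recursion for \<^const>\<open>Ck_on\<close> leads to constants.\<close>

lemma smooth_on_affine:
  fixes L :: "'p::euclidean_space \<Rightarrow> 'v::real_normed_vector"
  assumes "linear L"
  shows "smooth_on S (\<lambda>x. c + L x)"
proof -
  note der = affine_has_derivative[OF assms, of c]
  have "Ck_on m S (\<lambda>x. c + L x)" for m
  proof (cases m)
    case 0
    then show ?thesis
      using der by (auto intro!: continuous_at_imp_continuous_on has_derivative_continuous)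
  next
    case (Suc m')
    have "frechet_derivative (\<lambda>x. c + L x) (at \<theta>) = L" for \<theta>
      using frechet_derivative_at[OF der] by simp
    moreover have "(\<lambda>x. c + L x) differentiable (at \<theta>)" for \<theta>
      using der by (auto simp: differentiable_def)
    ultimately show ?thesis
      by (simp add: Suc smooth_on_const[unfolded smooth_on_def, rule_format])
  qed
  then show ?thesis
    by (simp add: smooth_on_def)
qed

lemma horizontal_affine_iff:
  fixes L :: "'p::euclidean_space \<Rightarrow> real^'n^'n"
  assumes L: "linear L" and "open \<Theta>" and "\<And>\<theta>. \<theta> \<in> \<Theta> \<Longrightarrow> c + L \<theta> \<in> GL"
  shows "horizontal \<Theta> (\<lambda>\<theta>. c + L \<theta>) \<longleftrightarrow>
    (\<forall>b\<in>Basis. \<forall>\<theta>\<in>\<Theta>. transpose (c + L \<theta>) ** L b \<in> Sym)"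
  using assms by (simp add: horizontal_iff_Sym smooth_surface_def smooth_on_affine
      partial_eq[OF affine_has_derivative[OF L]])

lemma continuous_affine:
  fixes L :: "'p::euclidean_space \<Rightarrow> 'v::real_normed_vector"
  assumes "linear L"
  shows "continuous_on UNIV (\<lambda>x. c + L x)"
  using smooth_on_affine[OF assms] unfolding smooth_on_def by (metis Ck_on.simps(1))

section \<open>Surfaces spanned by matrices at the vertices of the simplex\<close>

primrec vertex :: "'k::finite option \<Rightarrow> real^'k" where
  "vertex None = 0"
| "vertex (Some j) = axis j 1"

primrec barycentric :: "real^'k \<Rightarrow> 'k option \<Rightarrow> real" where
  "barycentric \<theta> None = 1 - (\<Sum>j\<in>UNIV. \<theta> $ j)"
| "barycentric \<theta> (Some j) = \<theta> $ j"

lemma sum_option: "(\<Sum>i\<in>UNIV. f i) = f None + (\<Sum>j\<in>UNIV. f (Some (j :: 'k::finite)))"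
  by (simp add: UNIV_option_conv sum.reindex)

lemma sum_barycentric: "(\<Sum>i\<in>UNIV. barycentric \<theta> i) = 1"
  by (simp add: sum_option)

lemma barycentric_nonneg: "\<theta> \<in> unit_simplex \<Longrightarrow> barycentric \<theta> i \<ge> 0"
  by (cases i) (auto simp: unit_simplex_def)

lemma affine_surface_barycentric:
  "affine_surface A \<theta> = (\<Sum>i\<in>UNIV. barycentric \<theta> i *\<^sub>R A i)"
  by (simp add: affine_surface_def sum_option algebra_simps sum_subtractf scaleR_sum_left)

definition affine_surface_linear_part :: "('k option \<Rightarrow> real^'n^'n) \<Rightarrow> real^'k \<Rightarrow> real^'n^'n" where
  "affine_surface_linear_part A \<theta> = (\<Sum>i\<in>UNIV. \<theta> $ i *\<^sub>R (A (Some i) - A None))"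

lemma linear_affine_surface_linear_part: "linear (affine_surface_linear_part A)"
  by (rule linearI)
    (simp_all add: affine_surface_linear_part_def scaleR_add_left sum.distrib scaleR_sum_right)

lemma affine_surface_eq: "affine_surface A = (\<lambda>\<theta>. A None + affine_surface_linear_part A \<theta>)"
  by (simp add: fun_eq_iff affine_surface_def affine_surface_linear_part_def)

lemma affine_surface_linear_part_axis:
  "affine_surface_linear_part A (axis j 1) = A (Some j) - A None"
  by (simp add: affine_surface_linear_part_def axis_def if_distrib[of "\<lambda>x. x *\<^sub>R _"] cong: if_cong)

lemma affine_surface_vertex: "affine_surface A (vertex i) = A i"
  by (cases i) (simp_all add: affine_surface_eq affine_surface_linear_part_axis
      linear_0[OF linear_affine_surface_linear_part])

lemma affine_surface_segment:
  "affine_surface A ((1 - t) *\<^sub>R x + t *\<^sub>R y) =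
    (1 - t) *\<^sub>R affine_surface A x + t *\<^sub>R affine_surface A y"
  using linear_affine_surface_linear_part[of A]
  by (simp add: affine_surface_eq linear_add linear_cmul linear_diff algebra_simps)

lemma vertex_in_unit_simplex: "vertex i \<in> unit_simplex"
  by (cases i) (auto simp: unit_simplex_def axis_def)

lemma convex_unit_simplex: "convex unit_simplex"
proof (rule convexI)
  fix x y :: "real^'k" and u v :: real
  assume "x \<in> unit_simplex" "y \<in> unit_simplex" "0 \<le> u" "0 \<le> v" "u + v = 1"
  then have "u * (\<Sum>j\<in>UNIV. x $ j) + v * (\<Sum>j\<in>UNIV. y $ j) \<le> 1"
    by (intro convex_bound_le) (auto simp: unit_simplex_def)
  with \<open>x \<in> unit_simplex\<close> \<open>y \<in> unit_simplex\<close> \<open>0 \<le> u\<close> \<open>0 \<le> v\<close>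
  show "u *\<^sub>R x + v *\<^sub>R y \<in> unit_simplex"
    by (simp add: unit_simplex_def sum.distrib sum_distrib_left)
qed

text \<open>Given horizontality, symmetry of \<open>A\<^sub>i\<^sup>* (A\<^sub>j - A\<^sub>0)\<close> holds at every vertex. The vertex zero yields
  the products with \<open>A\<^sub>0\<close>, and adding these back yields all others. Conversely, the value of the
  surface at any parameter, inside the simplex or not, is a linear combination of the \<open>A\<^sub>i\<close>, and
  symmetric matrices form a subspace.\<close>

lemma horizontal_affine_surface_iff:
  fixes A :: "'k::finite option \<Rightarrow> real^'n^'n"
  assumes "open \<Theta>" and simplex: "unit_simplex \<subseteq> \<Theta>"
    and GL: "\<And>\<theta>. \<theta> \<in> \<Theta> \<Longrightarrow> affine_surface A \<theta> \<in> GL"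
  shows "horizontal \<Theta> (affine_surface A) \<longleftrightarrow> (\<forall>i j. transpose (A j) ** A i \<in> Sym)"
proof -
  have iff: "horizontal \<Theta> (affine_surface A) \<longleftrightarrow>
      (\<forall>j. \<forall>\<theta>\<in>\<Theta>. transpose (affine_surface A \<theta>) ** (A (Some j) - A None) \<in> Sym)"
    using horizontal_affine_iff[OF linear_affine_surface_linear_part[of A] \<open>open \<Theta>\<close>, of "A None"] GL
    by (simp add: affine_surface_eq ball_Basis_vec affine_surface_linear_part_axis)
  show ?thesis
    unfolding iff
  proof (intro iffI allI ballI)
    fix i j
    assume "\<forall>j. \<forall>\<theta>\<in>\<Theta>. transpose (affine_surface A \<theta>) ** (A (Some j) - A None) \<in> Sym"
    then have "transpose (affine_surface A (vertex i)) ** (A (Some j) - A None) \<in> Sym" for i j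
      using simplex vertex_in_unit_simplex by blast
    then have step: "transpose (A i) ** A (Some j) - transpose (A i) ** A None \<in> Sym" for i j
      by (simp add: affine_surface_vertex matrix_mult_diff_right)
    have swap: "transpose X ** Y \<in> Sym \<Longrightarrow> transpose Y ** X \<in> Sym" for X Y :: "real^'n^'n"
      by (simp add: transpose_mult_in_Sym_iff)
    have add: "Y \<in> Sym \<Longrightarrow> X - Y \<in> Sym \<Longrightarrow> X \<in> Sym" for X Y :: "real^'n^'n"
      using subspace_add[OF subspace_Sym, of "X - Y" Y] by simp
    have "transpose (A None) ** A (Some i) \<in> Sym" for i
      by (rule add[OF transpose_mult_self_Sym step])
    then have None: "transpose (A i) ** A None \<in> Sym" for i
      by (cases i) (auto intro: swap transpose_mult_self_Sym)
    show "transpose (A j) ** A i \<in> Sym"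
      by (cases i) (auto intro: None add[OF None step])
  next
    fix j \<theta>
    assume sym: "\<forall>i j. transpose (A j) ** A i \<in> Sym"
    have "transpose (A i) ** (A (Some j) - A None) \<in> Sym" for i
      using sym by (simp add: matrix_mult_diff_right subspace_diff[OF subspace_Sym])
    then show "transpose (affine_surface A \<theta>) ** (A (Some j) - A None) \<in> Sym"
      unfolding affine_surface_barycentric linear_sum[OF linear_transpose_mult]
        linear_cmul[OF linear_transpose_mult]
      by (intro subspace_sum[OF subspace_Sym] subspace_scale[OF subspace_Sym])
  qed
qed

text \<open>Every edge of the simplex maps to a segment of invertible matrices, whence the positive-definite
  ratios. Conversely, factoring \<open>A\<^sub>0\<close> out of the surface leaves a convex combination of the ratios
  \<open>T\<^sub>i\<^sub>0\<close>, which is positive definite over the simplex.\<close>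

lemma horizontal_affine_surface_iff_ratios:
  fixes A :: "'k::finite option \<Rightarrow> real^'n^'n"
  assumes GL: "\<And>j. A j \<in> GL"
  shows "(\<exists>\<Theta>. open \<Theta> \<and> unit_simplex \<subseteq> \<Theta> \<and> horizontal \<Theta> (affine_surface A)) \<longleftrightarrow>
    (\<forall>i j. \<exists>T\<in>Sym_pd. A i = T ** A j)"
proof (intro iffI allI)
  fix i j
  assume "\<exists>\<Theta>. open \<Theta> \<and> unit_simplex \<subseteq> \<Theta> \<and> horizontal \<Theta> (affine_surface A)"
  then obtain \<Theta> where \<Theta>: "open \<Theta>" "unit_simplex \<subseteq> \<Theta>" and hor: "horizontal \<Theta> (affine_surface A)"
    by blast
  then have inv: "affine_surface A \<theta> \<in> GL" if "\<theta> \<in> \<Theta>" for \<theta>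
    using that by (simp add: horizontal_def smooth_surface_def)
  show "\<exists>T\<in>Sym_pd. A i = T ** A j"
  proof (rule Sym_pd_ratio_if_segment_in_GL)
    show "transpose (A j) ** A i \<in> Sym"
      using horizontal_affine_surface_iff[OF \<Theta> inv] hor by blast
    fix t :: real
    assume "0 \<le> t" "t \<le> 1"
    then have "(1 - t) *\<^sub>R vertex j + t *\<^sub>R vertex i \<in> unit_simplex"
      by (intro convexD[OF convex_unit_simplex] vertex_in_unit_simplex) auto
    then have "affine_surface A ((1 - t) *\<^sub>R vertex j + t *\<^sub>R vertex i) \<in> GL"
      using \<Theta> inv by blast
    then show "(1 - t) *\<^sub>R A j + t *\<^sub>R A i \<in> GL"
      by (simp add: affine_surface_segment affine_surface_vertex)
  qed
next
  assume ratios: "\<forall>i j. \<exists>T\<in>Sym_pd. A i = T ** A j"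
  then have "\<forall>i. \<exists>T. T \<in> Sym_pd \<and> A i = T ** A None"
    by blast
  then obtain T where "\<forall>i. T i \<in> Sym_pd \<and> A i = T i ** A None"
    by (rule choice[THEN exE])
  then have T: "\<And>i. T i \<in> Sym_pd" "\<And>i. A i = T i ** A None"
    by blast+
  define \<Theta> where "\<Theta> = affine_surface A -` GL"
  have "open \<Theta>"
    unfolding \<Theta>_def using continuous_affine[OF linear_affine_surface_linear_part[of A], of "A None"]
    by (intro open_vimage open_GL) (simp add: affine_surface_eq)
  moreover have simplex: "unit_simplex \<subseteq> \<Theta>"
  proof
    fix \<theta> :: "real^'k"
    assume "\<theta> \<in> unit_simplex"
    then have "(\<Sum>i\<in>UNIV. barycentric \<theta> i *\<^sub>R T i) \<in> Sym_pd"
      by (intro convex_combination_Sym_pd T barycentric_nonneg sum_barycentric)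
    then have "(\<Sum>i\<in>UNIV. barycentric \<theta> i *\<^sub>R T i) ** A None \<in> GL"
      using GL Sym_pd_subset_GL by (blast intro: GL_mult)
    moreover have "affine_surface A \<theta> = (\<Sum>i\<in>UNIV. barycentric \<theta> i *\<^sub>R T i) ** A None"
    proof -
      have lin: "linear (\<lambda>X :: real^'n^'n. X ** A None)"
        using linear_compose[OF linear_transpose linear_transpose_mult[of "A None"]]
        by (simp add: o_def)
      have "(\<Sum>i\<in>UNIV. barycentric \<theta> i *\<^sub>R A i) = (\<Sum>i\<in>UNIV. barycentric \<theta> i *\<^sub>R (T i ** A None))"
        by (intro sum.cong refl arg_cong[where f = "scaleR _"] T(2))
      then show ?thesis
        by (simp add: affine_surface_barycentric linear_sum[OF lin] linear_cmul[OF lin])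
    qed
    ultimately show "\<theta> \<in> \<Theta>"
      by (simp add: \<Theta>_def)
  qed
  moreover have "horizontal \<Theta> (affine_surface A)"
  proof -
    have "transpose (A j) ** A i \<in> Sym" for i j
      using ratios by (metis transpose_mult_Sym_if_ratio)
    then show ?thesis
      using horizontal_affine_surface_iff[OF \<open>open \<Theta>\<close> simplex, of A] by (simp add: \<Theta>_def)
  qed
  ultimately show "\<exists>\<Theta>. open \<Theta> \<and> unit_simplex \<subseteq> \<Theta> \<and> horizontal \<Theta> (affine_surface A)"
    by blast
qed

section \<open>Horizontal lines\<close>

text \<open>The same argument as for surfaces, with the segment \<open>[0, 1]\<close> in place of the simplex. Since the
  parameter set has to be an interval, the open set of parameters with invertible value is replaced
  by its connected component.\<close>

lemma horizontal_line_iff_ratio: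
  fixes A B :: "real^'n^'n"
  assumes GL: "A \<in> GL"
  shows "(\<exists>I :: real set. open I \<and> is_interval I \<and> 0 \<in> I \<and> 1 \<in> I \<and>
      horizontal I (\<lambda>\<theta>. (1 - \<theta>) *\<^sub>R A + \<theta> *\<^sub>R B)) \<longleftrightarrow> (\<exists>T\<in>Sym_pd. B = T ** A)"
proof -
  define f where "f = (\<lambda>\<theta>. A + \<theta> *\<^sub>R (B - A))"
  have f: "(\<lambda>\<theta>. (1 - \<theta>) *\<^sub>R A + \<theta> *\<^sub>R B) = f"
    by (simp add: f_def fun_eq_iff algebra_simps)
  have lin: "linear (\<lambda>\<theta>. \<theta> *\<^sub>R (B - A))"
    by (rule linearI) (simp_all add: scaleR_add_left)
  have iff: "horizontal I f \<longleftrightarrow> (\<forall>\<theta>\<in>I. transpose (f \<theta>) ** (B - A) \<in> Sym)"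
    if "open I" "\<And>\<theta>. \<theta> \<in> I \<Longrightarrow> f \<theta> \<in> GL" for I
    using horizontal_affine_iff[OF lin that(1), of A] that(2) by (simp add: f_def)
  show ?thesis
    unfolding f
  proof
    assume "\<exists>I. open I \<and> is_interval I \<and> 0 \<in> I \<and> 1 \<in> I \<and> horizontal I f"
    then obtain I where I: "open I" "is_interval I" "0 \<in> I" "1 \<in> I" and hor: "horizontal I f"
      by blast
    then have inv: "f \<theta> \<in> GL" if "\<theta> \<in> I" for \<theta>
      using that by (simp add: horizontal_def smooth_surface_def)
    show "\<exists>T\<in>Sym_pd. B = T ** A"
    proof (rule Sym_pd_ratio_if_segment_in_GL)
      have "transpose (f 0) ** (B - A) \<in> Sym"
        using iff[OF I(1) inv] hor I(3) by blast
      then have "transpose A ** B - transpose A ** A \<in> Sym"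
        by (simp add: f_def matrix_mult_diff_right)
      from subspace_add[OF subspace_Sym this transpose_mult_self_Sym[of A]]
      show "transpose A ** B \<in> Sym"
        by simp
      fix t :: real
      assume "0 \<le> t" "t \<le> 1"
      then have "t \<in> I"
        using I by (meson mem_is_interval_1_I)
      then show "(1 - t) *\<^sub>R A + t *\<^sub>R B \<in> GL"
        using inv fun_cong[OF f, of t] by simp
    qed
  next
    assume "\<exists>T\<in>Sym_pd. B = T ** A"
    then obtain T where T: "T \<in> Sym_pd" "B = T ** A"
      by blast
    define U where "U = f -` GL"
    define I where "I = connected_component_set U 0"
    have "open U"
      unfolding U_def f_def by (intro open_vimage open_GL continuous_affine lin)
    then have "open I"
      by (simp add: I_def open_connected_component)
    moreover have "is_interval I"
      by (simp add: I_def is_interval_connected_1)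
    moreover have "{0..1} \<subseteq> U"
    proof
      fix t :: real
      assume t: "t \<in> {0..1}"
      have "f t *v x \<noteq> 0" if "x \<noteq> 0" for x
      proof
        assume 0: "f t *v x = 0"
        have Ax: "A *v x \<noteq> 0"
          using GL that by (auto simp: GL_iff_inj)
        have "f t *v x = (1 - t) *\<^sub>R (A *v x) + t *\<^sub>R (T *v (A *v x))"
          by (simp add: f[symmetric] T(2) matrix_vector_mult_add_rdistrib matrix_vector_mul_assoc
              flip: scaleR_matrix_vector_assoc)
        with 0 have "0 = (1 - t) * ((A *v x) \<bullet> (A *v x)) + t * ((A *v x) \<bullet> (T *v (A *v x)))"
          by (metis inner_add_right inner_scaleR_right inner_zero_right)
        moreover have "(A *v x) \<bullet> (A *v x) > 0" "(A *v x) \<bullet> (T *v (A *v x)) > 0"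
          using T Ax by (auto simp: Sym_pd_def)
        ultimately show False
          using t by (smt (verit) atLeastAtMost_iff mult_nonneg_nonneg mult_pos_pos)
      qed
      then show "t \<in> U"
        by (auto simp: U_def GL_iff_inj)
    qed
    then have "{0..1} \<subseteq> I"
      unfolding I_def by (intro connected_component_maximal) auto
    moreover have "horizontal I f"
    proof -
      have sym: "transpose A ** B \<in> Sym"
        using T by (simp add: transpose_mult_Sym_if_ratio)
      then have "transpose B ** A \<in> Sym"
        by (simp add: transpose_mult_in_Sym_iff)
      then have "transpose A ** (B - A) \<in> Sym" "transpose B ** (B - A) \<in> Sym"
        using sym transpose_mult_self_Sym by (auto simp: matrix_mult_diff_right intro!: subspace_diff[OF subspace_Sym])
      then have "transpose (f \<theta>) ** (B - A) \<in> Sym" for \<theta>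
        unfolding f[symmetric] linear_add[OF linear_transpose_mult] linear_cmul[OF linear_transpose_mult]
        by (intro subspace_add[OF subspace_Sym] subspace_scale[OF subspace_Sym])
      moreover have "f \<theta> \<in> GL" if "\<theta> \<in> I" for \<theta>
        using that connected_component_subset[of U 0] by (auto simp: I_def U_def)
      ultimately show ?thesis
        using iff[OF \<open>open I\<close>] by blast
    qed
    ultimately show "\<exists>I. open I \<and> is_interval I \<and> 0 \<in> I \<and> 1 \<in> I \<and> horizontal I f"
      by force
  qed
qed

theorem proposition8:
  shows "(\<forall>(\<Theta> :: (real^'k) set) (A :: real^'k \<Rightarrow> real^'n^'n).
      smooth_surface \<Theta> A \<longrightarrow>
        (horizontal \<Theta> A \<longleftrightarrow>
          (\<forall>j. \<forall>\<theta>\<in>\<Theta>.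
             partial (axis j 1) (\<lambda>\<theta>. transpose (A \<theta>)) \<theta> ** A \<theta> =
             transpose (A \<theta>) ** partial (axis j 1) A \<theta>)))
    \<and>
    (\<forall>(\<Theta> :: (real^'k) set) (A :: 'k option \<Rightarrow> real^'n^'n).
      open \<Theta> \<and> unit_simplex \<subseteq> \<Theta> \<and> (\<forall>\<theta>\<in>\<Theta>. affine_surface A \<theta> \<in> GL) \<longrightarrow>
        (horizontal \<Theta> (affine_surface A) \<longleftrightarrow>
          (\<forall>i j. transpose (A j) ** A i = transpose (A i) ** A j)))
    \<and>
    (\<forall>(\<Sigma>\<^sub>0 :: real^'n^'n) \<Sigma>\<^sub>1 A\<^sub>0 A\<^sub>1.
      \<Sigma>\<^sub>0 \<in> Sym_pd \<and> \<Sigma>\<^sub>1 \<in> Sym_pd \<and> \<Sigma>\<^sub>0 = sigma_map A\<^sub>0 \<and> \<Sigma>\<^sub>1 = sigma_map A\<^sub>1 \<longrightarrow>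
        ((\<exists>I :: real set. open I \<and> is_interval I \<and> 0 \<in> I \<and> 1 \<in> I \<and>
             horizontal I (\<lambda>\<theta>. (1 - \<theta>) *\<^sub>R A\<^sub>0 + \<theta> *\<^sub>R A\<^sub>1)) \<longleftrightarrow>
          (\<exists>T\<in>Sym_pd. A\<^sub>1 = T ** A\<^sub>0))
        \<and>
        (\<forall>T\<in>Sym_pd. A\<^sub>1 = T ** A\<^sub>0 \<longrightarrow>
          T ** \<Sigma>\<^sub>0 ** T = \<Sigma>\<^sub>1 \<and> (\<forall>S\<in>Sym_pd. S ** \<Sigma>\<^sub>0 ** S = \<Sigma>\<^sub>1 \<longrightarrow> S = T)))
    \<and>
    (\<forall>(\<Sigma> :: 'k option \<Rightarrow> real^'n^'n) A.
      (\<forall>j. \<Sigma> j = sigma_map (A j) \<and> \<Sigma> j \<in> Sym_pd) \<longrightarrow>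
        ((\<exists>\<Theta>. open \<Theta> \<and> unit_simplex \<subseteq> \<Theta> \<and> horizontal \<Theta> (affine_surface A)) \<longleftrightarrow>
          (\<forall>i j. \<exists>T\<in>Sym_pd. A i = T ** A j)))"
proof (intro conjI allI impI; (elim conjE)?)
  fix \<Theta> :: "(real^'k) set" and A :: "real^'k \<Rightarrow> real^'n^'n"
  assume "smooth_surface \<Theta> A"
  then show "horizontal \<Theta> A \<longleftrightarrow>
      (\<forall>j. \<forall>\<theta>\<in>\<Theta>. partial (axis j 1) (\<lambda>\<theta>. transpose (A \<theta>)) \<theta> ** A \<theta> =
        transpose (A \<theta>) ** partial (axis j 1) A \<theta>)"
    by (simp add: horizontal_iff_partial ball_Basis_vec)
next
  fix \<Theta> :: "(real^'k) set" and A :: "'k option \<Rightarrow> real^'n^'n"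
  assume "open \<Theta>" "unit_simplex \<subseteq> \<Theta>" "\<forall>\<theta>\<in>\<Theta>. affine_surface A \<theta> \<in> GL"
  then show "horizontal \<Theta> (affine_surface A) \<longleftrightarrow>
      (\<forall>i j. transpose (A j) ** A i = transpose (A i) ** A j)"
    by (subst horizontal_affine_surface_iff) (auto simp: transpose_mult_in_Sym_iff)
next
  fix \<Sigma>\<^sub>0 \<Sigma>\<^sub>1 A\<^sub>0 A\<^sub>1 :: "real^'n^'n"
  assume "\<Sigma>\<^sub>0 \<in> Sym_pd" "\<Sigma>\<^sub>0 = sigma_map A\<^sub>0"
  then show "(\<exists>I :: real set. open I \<and> is_interval I \<and> 0 \<in> I \<and> 1 \<in> I \<and>
      horizontal I (\<lambda>\<theta>. (1 - \<theta>) *\<^sub>R A\<^sub>0 + \<theta> *\<^sub>R A\<^sub>1)) \<longleftrightarrow> (\<exists>T\<in>Sym_pd. A\<^sub>1 = T ** A\<^sub>0)"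
    by (intro horizontal_line_iff_ratio GL_if_sigma_map_Sym_pd) simp
next
  fix \<Sigma>\<^sub>0 \<Sigma>\<^sub>1 A\<^sub>0 A\<^sub>1 :: "real^'n^'n"
  assume \<Sigma>: "\<Sigma>\<^sub>0 \<in> Sym_pd" "\<Sigma>\<^sub>0 = sigma_map A\<^sub>0" "\<Sigma>\<^sub>1 = sigma_map A\<^sub>1"
  show "\<forall>T\<in>Sym_pd. A\<^sub>1 = T ** A\<^sub>0 \<longrightarrow>
      T ** \<Sigma>\<^sub>0 ** T = \<Sigma>\<^sub>1 \<and> (\<forall>S\<in>Sym_pd. S ** \<Sigma>\<^sub>0 ** S = \<Sigma>\<^sub>1 \<longrightarrow> S = T)"
  proof (intro ballI impI)
    fix T :: "real^'n^'n"
    assume T: "T \<in> Sym_pd" "A\<^sub>1 = T ** A\<^sub>0"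
    then have "T ** \<Sigma>\<^sub>0 ** T = \<Sigma>\<^sub>1"
      using \<Sigma> by (simp add: Riccati_ratio Sym_pd_def)
    moreover have "A\<^sub>0 \<in> GL"
      using \<Sigma> by (simp add: GL_if_sigma_map_Sym_pd)
    ultimately show "T ** \<Sigma>\<^sub>0 ** T = \<Sigma>\<^sub>1 \<and> (\<forall>S\<in>Sym_pd. S ** \<Sigma>\<^sub>0 ** S = \<Sigma>\<^sub>1 \<longrightarrow> S = T)"
      using Riccati_unique[OF _ T(1)] \<Sigma>(2) by simp
  qed
next
  fix \<Sigma> A :: "'k option \<Rightarrow> real^'n^'n"
  assume "\<forall>j. \<Sigma> j = sigma_map (A j) \<and> \<Sigma> j \<in> Sym_pd"
  then have "A j \<in> GL" for j
    by (metis GL_if_sigma_map_Sym_pd)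
  then show "(\<exists>\<Theta>. open \<Theta> \<and> unit_simplex \<subseteq> \<Theta> \<and> horizontal \<Theta> (affine_surface A)) \<longleftrightarrow>
      (\<forall>i j. \<exists>T\<in>Sym_pd. A i = T ** A j)"
    by (rule horizontal_affine_surface_iff_ratios)
qed

end
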